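(* Suppose that the eigenvalue problem of a $2m$-order elliptic equation on a domain $\Omega\subset\mathbb{R}^d$ is solved by the finite element method (conforming or non-conforming) of polynomial degree $k-1$, where $k>m\ge 1$, under a shape regular and quasi-uniform mesh with mesh parameter $h$. Let $\lambda_j$ denote the $j$th exact eigenvalue and $\lambda_j^h$ the $j$th numerical eigenvalue. Assume that the exact eigenvalues grow as $$\lambda_j=O(j^{2m/d}),$$ and that the relative error can be estimated by $$\frac{\lambda_j^h-\lambda_j}{\lambda_j}\approx h^{2(k-m)}\lambda_j^{k/m-1}.$$ Then, for $\alpha\in(0,2(k-m)]$, there are about $$j_N=N^{(k-m-\alpha/2)/(k-m)}\,(k-1)^{-d(k-m-\alpha/2)/(k-m)}$$ reliable numerical eigenvalues, with the relative error of $\lambda_{j_N}$ converging at rate $h^\alpha$. Here $N$ is the total number of degrees of freedom.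
   Context: The eigenvalue problem is to find $(\lambda,u)\in\mathbb{R}\times H$, for a suitable Hilbert space $H$, such that $a(u,v)=\lambda\,b(u,v)$ for all $v\in H$, where $a(\cdot,\cdot)$ is a bilinear form on $H$ deduced from a self-adjoint $2m$-order elliptic operator on a domain in $\mathbb{R}^d$ and $b(\cdot,\cdot)$ is a symmetric positive definite bilinear form on $H$. Multiple eigenvalues are included, and eigenvalues are listed in nondecreasing order. The numerical eigenvalues $\lambda_j^h$ are those of the corresponding discrete problem on a finite element space of piecewise polynomials of degree $k-1$ (so $k=2$ means linear elements); on a shape regular and quasi-uniform mesh with mesh parameter $h$ in $\mathbb{R}^d$, such a space has total degrees of freedom $N=O((k-1)^dh^{-d})$. In the relative error assumption, "$\approx$" means that both upper and lower error bounds are of the same order. The theorem is stated informally: "reliable" refers to numerical eigenvalues whose relative error converges at least at the prescribed rate $h^\alpha$, and "about $j_N$" is an order-of-magnitude count, obtained by setting $h^{2(k-m)}\lambda_j^{k/m-1}=h^\alpha$, substituting the growth $j^{2m/d}$ for $\lambda_j$ to get $j=h^{-d(k-m-\alpha/2)/(k-m)}$, and expressing $h$ through $N$. *)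

theory Defs
  imports "HOL-Analysis.Analysis" "HOL-Library.Landau_Symbols"
begin

section \<open>Measurable functions modulo equality almost everywhere\<close>

text \<open>
  All trial and test functions live in the real vector space of Borel functions on the whole
  space modulo null sets, so that dimensions of eigenspaces and of finite element spaces are the
  library's \<open>dim\<close>; \<open>rep_mfun\<close> picks a Borel representative. A function on a domain \<open>\<Omega>\<close> is represented by its extension by zero.
\<close>

quotient_type (overloaded) 'd mfun = "real ^ ('d::finite) \<Rightarrow> real" / partial:
  "\<lambda>f g. f \<in> borel_measurable borel \<and> g \<in> borel_measurable borel \<and> (AE x in lborel. f x = g x)"
  morphisms rep_mfun abs_mfun
proof (rule part_equivpI)
  show "\<exists>f :: real ^ 'd \<Rightarrow> real. f \<in> borel_measurable borel \<and> f \<in> borel_measurable borel \<and>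
      (AE x in lborel. f x = f x)"
    by (rule exI[of _ "\<lambda>_. 0"]) simp
qed (auto simp: symp_def transp_def)

instantiation mfun :: (finite) real_vector
begin

lift_definition zero_mfun :: "'a mfun" is "\<lambda>_. 0"
  by simp

lift_definition plus_mfun :: "'a mfun \<Rightarrow> 'a mfun \<Rightarrow> 'a mfun" is "\<lambda>f g x. f x + g x"
  by auto

lift_definition minus_mfun :: "'a mfun \<Rightarrow> 'a mfun \<Rightarrow> 'a mfun" is "\<lambda>f g x. f x - g x"
  by auto

lift_definition uminus_mfun :: "'a mfun \<Rightarrow> 'a mfun" is "\<lambda>f x. - f x"
  by auto

lift_definition scaleR_mfun :: "real \<Rightarrow> 'a mfun \<Rightarrow> 'a mfun" is "\<lambda>c f x. c * f x"
  by auto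

instance
  by standard (transfer; auto simp: algebra_simps)+

end


section \<open>Weak derivatives and Sobolev spaces\<close>

text \<open>
  An iterated partial derivative is indexed by the list of its directions; its order is the
  length of the list.
\<close>

primrec iter_partial :: "'d::finite list \<Rightarrow> (real ^ 'd \<Rightarrow> real) \<Rightarrow> real ^ 'd \<Rightarrow> real" where
  "iter_partial [] f = f"
| "iter_partial (i # is) f = (\<lambda>x. frechet_derivative (iter_partial is f) (at x) (axis i 1))"

definition test_functions :: "(real ^ 'd::finite) set \<Rightarrow> (real ^ 'd \<Rightarrow> real) set" where
  "test_functions \<Omega> = {\<phi>. (\<forall>is x. iter_partial is \<phi> differentiable (at x)) \<and>
     (\<exists>K. compact K \<and> K \<subseteq> \<Omega> \<and> (\<forall>x. x \<notin> K \<longrightarrow> \<phi> x = 0))}"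

definition L2 :: "(real ^ 'd::finite) set \<Rightarrow> 'd mfun set" where
  "L2 \<Omega> = {u. integrable lborel (\<lambda>x. (rep_mfun u x)\<^sup>2) \<and> (AE x in lborel. x \<notin> \<Omega> \<longrightarrow> rep_mfun u x = 0)}"

definition is_weak_deriv ::
    "(real ^ 'd::finite) set \<Rightarrow> 'd list \<Rightarrow> 'd mfun \<Rightarrow> 'd mfun \<Rightarrow> bool" where
  "is_weak_deriv \<Omega> is u w \<longleftrightarrow> (\<forall>\<phi>\<in>test_functions \<Omega>.
     (LINT x:\<Omega>|lborel. rep_mfun u x * iter_partial is \<phi> x)
       = (-1) ^ length is * (LINT x:\<Omega>|lborel. rep_mfun w x * \<phi> x))"

definition sobolev :: "nat \<Rightarrow> (real ^ 'd::finite) set \<Rightarrow> 'd mfun set" where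
  "sobolev m \<Omega> = {u \<in> L2 \<Omega>. \<forall>is. length is \<le> m \<longrightarrow> (\<exists>w\<in>L2 \<Omega>. is_weak_deriv \<Omega> is u w)}"

definition weak_deriv :: "(real ^ 'd::finite) set \<Rightarrow> 'd list \<Rightarrow> 'd mfun \<Rightarrow> 'd mfun" where
  "weak_deriv \<Omega> is u = (SOME w. w \<in> L2 \<Omega> \<and> is_weak_deriv \<Omega> is u w)"

definition sobolev_norm :: "nat \<Rightarrow> (real ^ 'd::finite) set \<Rightarrow> 'd mfun \<Rightarrow> real" where
  "sobolev_norm m \<Omega> u = sqrt (\<Sum>is | length is \<le> m.
     LINT x:\<Omega>|lborel. (rep_mfun (weak_deriv \<Omega> is u) x)\<^sup>2)"

text \<open>
  The admissible Hilbert spaces lie between the closure of the test functions and the full Sobolev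
  space; the choice encodes the boundary conditions.
\<close>

definition hilbert_between :: "nat \<Rightarrow> (real ^ 'd::finite) set \<Rightarrow> 'd mfun set \<Rightarrow> bool" where
  "hilbert_between m \<Omega> H \<longleftrightarrow> subspace H \<and> abs_mfun ` test_functions \<Omega> \<subseteq> H \<and> H \<subseteq> sobolev m \<Omega> \<and>
     (\<forall>u :: nat \<Rightarrow> 'd mfun. range u \<subseteq> H \<and>
        (\<forall>e>0. \<exists>M. \<forall>i\<ge>M. \<forall>j\<ge>M. sobolev_norm m \<Omega> (u i - u j) < e) \<longrightarrow>
        (\<exists>v\<in>H. (\<lambda>i. sobolev_norm m \<Omega> (u i - v)) \<longlonglongrightarrow> 0))"


section \<open>Self-adjoint elliptic eigenvalue problems\<close>

definition sym_bilinear_on ::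
    "'v::real_vector set \<Rightarrow> ('v \<Rightarrow> 'v \<Rightarrow> real) \<Rightarrow> bool" where
  "sym_bilinear_on S f \<longleftrightarrow>
     (\<forall>u\<in>S. \<forall>v\<in>S. f u v = f v u) \<and>
     (\<forall>u\<in>S. \<forall>v\<in>S. \<forall>w\<in>S. f (u + v) w = f u w + f v w) \<and>
     (\<forall>c. \<forall>u\<in>S. \<forall>w\<in>S. f (c *\<^sub>R u) w = c * f u w)"

definition pos_def_on :: "'v::real_vector set \<Rightarrow> ('v \<Rightarrow> 'v \<Rightarrow> real) \<Rightarrow> bool" where
  "pos_def_on S f \<longleftrightarrow> (\<forall>u\<in>S. u \<noteq> 0 \<longrightarrow> f u u > 0)"

text \<open>
  Coefficients \<open>A is js\<close> of the operator
  \<open>L u = \<Sum> (-1)^|js| D^js (A is js D^is u)\<close>, the sum extending over \<open>|is|, |js| \<le> m\<close>.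
\<close>

definition elliptic_coeffs ::
    "nat \<Rightarrow> (real ^ 'd::finite) set \<Rightarrow> ('d list \<Rightarrow> 'd list \<Rightarrow> real ^ 'd \<Rightarrow> real) \<Rightarrow> bool" where
  "elliptic_coeffs m \<Omega> A \<longleftrightarrow>
     (\<forall>is js. A is js \<in> borel_measurable borel) \<and>
     (\<exists>M. \<forall>is js. length is \<le> m \<and> length js \<le> m \<longrightarrow> (\<forall>x\<in>\<Omega>. \<bar>A is js x\<bar> \<le> M)) \<and>
     (\<forall>is js. length is \<le> m \<and> length js \<le> m \<longrightarrow> (\<forall>x\<in>\<Omega>. A is js x = A js is x)) \<and>
     (\<exists>c>0. \<forall>x\<in>\<Omega>. \<forall>\<xi>.
        (\<Sum>is | length is = m. \<Sum>js | length js = m.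
            A is js x * prod_list (map (($) \<xi>) is) * prod_list (map (($) \<xi>) js))
          \<ge> c * norm \<xi> ^ (2 * m))"

definition elliptic_form :: "nat \<Rightarrow> (real ^ 'd::finite) set \<Rightarrow>
    ('d list \<Rightarrow> 'd list \<Rightarrow> real ^ 'd \<Rightarrow> real) \<Rightarrow> 'd mfun \<Rightarrow> 'd mfun \<Rightarrow> real" where
  "elliptic_form m \<Omega> A u v = (\<Sum>is | length is \<le> m. \<Sum>js | length js \<le> m.
     LINT x:\<Omega>|lborel. A is js x * rep_mfun (weak_deriv \<Omega> is u) x * rep_mfun (weak_deriv \<Omega> js v) x)"

text \<open>
  The form \<open>a\<close> realises the operator weakly: tested with compactly supported smooth functions it
  is the volume integral above. Boundary integrals (e.g. from Robin conditions) vanish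
  there and are therefore allowed in \<open>a\<close>.
\<close>

definition deduced_from_elliptic_operator ::
    "nat \<Rightarrow> (real ^ 'd::finite) set \<Rightarrow> 'd mfun set \<Rightarrow> ('d mfun \<Rightarrow> 'd mfun \<Rightarrow> real) \<Rightarrow> bool" where
  "deduced_from_elliptic_operator m \<Omega> H a \<longleftrightarrow>
     sym_bilinear_on H a \<and>
     (\<exists>M. \<forall>u\<in>H. \<forall>v\<in>H. \<bar>a u v\<bar> \<le> M * sobolev_norm m \<Omega> u * sobolev_norm m \<Omega> v) \<and>
     (\<exists>A. elliptic_coeffs m \<Omega> A \<and>
        (\<forall>u\<in>H. \<forall>\<phi>\<in>test_functions \<Omega>. a u (abs_mfun \<phi>) = elliptic_form m \<Omega> A u (abs_mfun \<phi>)))"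

definition eigenspace ::
    "'v::real_vector set \<Rightarrow> ('v \<Rightarrow> 'v \<Rightarrow> real) \<Rightarrow> ('v \<Rightarrow> 'v \<Rightarrow> real) \<Rightarrow> real \<Rightarrow> 'v set" where
  "eigenspace S a b \<mu> = {u \<in> S. \<forall>v\<in>S. a u v = \<mu> * b u v}"

text \<open>
  \<open>lam\<close>, indexed by \<open>J\<close>, lists all eigenvalues in nondecreasing order, each as often as its (finite)
  multiplicity. Numbers that are not eigenvalues have eigenspace \<open>{0}\<close> and do not occur.
\<close>

definition lists_eigenvalues :: "'v::real_vector set \<Rightarrow> ('v \<Rightarrow> 'v \<Rightarrow> real) \<Rightarrow> ('v \<Rightarrow> 'v \<Rightarrow> real) \<Rightarrow>
    nat set \<Rightarrow> (nat \<Rightarrow> real) \<Rightarrow> bool" where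
  "lists_eigenvalues S a b J lam \<longleftrightarrow> mono_on J lam \<and>
     (\<forall>\<mu>. finite {j\<in>J. lam j = \<mu>} \<and>
        (\<exists>B. finite B \<and> independent B \<and> span B = eigenspace S a b \<mu> \<and>
             card B = card {j\<in>J. lam j = \<mu>}))"

definition elliptic_eigenproblem :: "nat \<Rightarrow> (real ^ 'd::finite) set \<Rightarrow> 'd mfun set \<Rightarrow>
    ('d mfun \<Rightarrow> 'd mfun \<Rightarrow> real) \<Rightarrow> ('d mfun \<Rightarrow> 'd mfun \<Rightarrow> real) \<Rightarrow> (nat \<Rightarrow> real) \<Rightarrow> bool" where
  "elliptic_eigenproblem m \<Omega> H a b lam \<longleftrightarrow>
     open \<Omega> \<and> connected \<Omega> \<and> \<Omega> \<noteq> {} \<and> hilbert_between m \<Omega> H \<and>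
     deduced_from_elliptic_operator m \<Omega> H a \<and>
     sym_bilinear_on H b \<and> pos_def_on H b \<and>
     lists_eigenvalues H a b {1..} lam"


section \<open>Finite element discretisations\<close>

text \<open>
  The cells need not be polytopes, so simplicial and hexahedral meshes as well as cells with curved
  boundary faces are covered.
\<close>

definition is_mesh :: "(real ^ 'd::finite) set \<Rightarrow> (real ^ 'd) set set \<Rightarrow> bool" where
  "is_mesh \<Omega> T \<longleftrightarrow> finite T \<and> \<Union>T = closure \<Omega> \<and>
     (\<forall>\<tau>\<in>T. compact \<tau> \<and> connected \<tau> \<and> interior \<tau> \<noteq> {} \<and> negligible (frontier \<tau>)) \<and>
     (\<forall>\<tau>\<in>T. \<forall>\<tau>'\<in>T. \<tau> \<noteq> \<tau>' \<longrightarrow> interior \<tau> \<inter> interior \<tau>' = {})"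

definition mesh_size :: "(real ^ 'd::finite) set set \<Rightarrow> real" where
  "mesh_size T = Max (diameter ` T)"

definition shape_regular :: "real set \<Rightarrow> (real \<Rightarrow> (real ^ 'd::finite) set set) \<Rightarrow> bool" where
  "shape_regular I T \<longleftrightarrow> (\<exists>\<sigma>>0. \<forall>h\<in>I. \<forall>\<tau>\<in>T h. \<exists>x. ball x (\<sigma> * diameter \<tau>) \<subseteq> \<tau>)"

definition quasi_uniform :: "real set \<Rightarrow> (real \<Rightarrow> (real ^ 'd::finite) set set) \<Rightarrow> bool" where
  "quasi_uniform I T \<longleftrightarrow> (\<exists>\<rho>>0. \<forall>h\<in>I. \<forall>\<tau>\<in>T h. diameter \<tau> \<ge> \<rho> * mesh_size (T h))"

definition polynomials_upto :: "nat \<Rightarrow> (real ^ 'd::finite \<Rightarrow> real) set" where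
  "polynomials_upto p = {q. \<exists>c :: ('d \<Rightarrow> nat) \<Rightarrow> real. \<forall>x.
     q x = (\<Sum>e | (\<Sum>i\<in>UNIV. e i) \<le> p. c e * (\<Prod>i\<in>UNIV. x $ i ^ e i))}"

definition piecewise_polynomials ::
    "(real ^ 'd::finite) set \<Rightarrow> (real ^ 'd) set set \<Rightarrow> nat \<Rightarrow> 'd mfun set" where
  "piecewise_polynomials \<Omega> T p = {u. (AE x in lborel. x \<notin> \<Omega> \<longrightarrow> rep_mfun u x = 0) \<and>
     (\<forall>\<tau>\<in>T. \<exists>q\<in>polynomials_upto p. AE x in lborel. x \<in> \<tau> \<inter> \<Omega> \<longrightarrow> rep_mfun u x = q x)}"

text \<open>
  A family of finite element discretisations, indexed by the mesh parameters \<open>h \<in> I\<close>, where \<open>I\<close>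
  accumulates at \<open>0\<close>. The space \<open>V h\<close> may or may not be contained in \<open>H\<close>; the discrete forms (for a
  non-conforming method, typically the elementwise versions of \<open>a\<close> and \<open>b\<close>) live on \<open>H + V h\<close> and
  coincide with \<open>a\<close> and \<open>b\<close> on \<open>H\<close>. In the conforming case \<open>V h \<subseteq> H\<close> the discrete problem is thus
  the restriction of the exact one.
\<close>

definition fe_discretisation :: "(real ^ 'd::finite) set \<Rightarrow> 'd mfun set \<Rightarrow>
    ('d mfun \<Rightarrow> 'd mfun \<Rightarrow> real) \<Rightarrow> ('d mfun \<Rightarrow> 'd mfun \<Rightarrow> real) \<Rightarrow> nat \<Rightarrow> real set \<Rightarrow>
    (real \<Rightarrow> (real ^ 'd) set set) \<Rightarrow> (real \<Rightarrow> 'd mfun set) \<Rightarrow>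
    (real \<Rightarrow> 'd mfun \<Rightarrow> 'd mfun \<Rightarrow> real) \<Rightarrow> (real \<Rightarrow> 'd mfun \<Rightarrow> 'd mfun \<Rightarrow> real) \<Rightarrow>
    (real \<Rightarrow> nat \<Rightarrow> real) \<Rightarrow> bool" where
  "fe_discretisation \<Omega> H a b p I T V ah bh lamh \<longleftrightarrow>
     I \<subseteq> {0<..} \<and> 0 islimpt I \<and> shape_regular I T \<and> quasi_uniform I T \<and>
     (\<forall>h\<in>I. is_mesh \<Omega> (T h) \<and> mesh_size (T h) = h \<and>
        subspace (V h) \<and> V h \<subseteq> piecewise_polynomials \<Omega> (T h) p \<and>
        sym_bilinear_on (span (H \<union> V h)) (ah h) \<and> (\<forall>u\<in>H. \<forall>v\<in>H. ah h u v = a u v) \<and>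
        sym_bilinear_on (span (H \<union> V h)) (bh h) \<and> (\<forall>u\<in>H. \<forall>v\<in>H. bh h u v = b u v) \<and>
        pos_def_on (V h) (bh h) \<and>
        lists_eigenvalues (V h) (ah h) (bh h) {1..dim (V h)} (lamh h))"


section \<open>Reliable numerical eigenvalues\<close>

text \<open>
  The modulus covers non-conforming methods, whose numerical eigenvalues may approximate from below.
\<close>

definition rel_err :: "(nat \<Rightarrow> real) \<Rightarrow> (real \<Rightarrow> nat \<Rightarrow> real) \<Rightarrow> real \<Rightarrow> nat \<Rightarrow> real" where
  "rel_err lam lamh h j = \<bar>lamh h j - lam j\<bar> / lam j"

text \<open>Indices among \<open>1, \<dots>, N\<close> whose relative error is within \<open>K h^\<alpha>\<close>.\<close>

definition reliable ::
    "(nat \<Rightarrow> real) \<Rightarrow> (real \<Rightarrow> nat \<Rightarrow> real) \<Rightarrow> nat \<Rightarrow> real \<Rightarrow> real \<Rightarrow> real \<Rightarrow> nat set" where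
  "reliable lam lamh N \<alpha> K h = {j\<in>{1..N}. rel_err lam lamh h j \<le> K * h powr \<alpha>}"

text \<open>
  The count \<open>j\<^sub>N\<close>: equating \<open>h powr (2 * (k - m)) * lam j powr (k / m - 1)\<close> with \<open>h powr \<alpha>\<close> for
  \<open>lam j = j powr (2 * m / d)\<close> gives \<open>j = h powr (- d * \<theta>)\<close>, and \<open>h\<close> is eliminated through
  \<open>N = (k - 1) ^ d * h powr (- d)\<close>.
\<close>

definition reliable_count :: "nat \<Rightarrow> nat \<Rightarrow> nat \<Rightarrow> real \<Rightarrow> nat \<Rightarrow> real" where
  "reliable_count d m k \<alpha> N =
     (let \<theta> = (real k - real m - \<alpha> / 2) / (real k - real m)
      in real N powr \<theta> * (real k - 1) powr (- real d * \<theta>))"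

end

theory Submission
  imports Defs
begin

text \<open>
  With \<open>s = k - m\<close> and \<open>X = N / (k - 1) ^ d\<close>, of order \<open>h powr (- d)\<close>, the count is \<open>X powr \<theta>\<close>, of
  order \<open>h powr (- d * \<theta>)\<close>. The error of the \<open>j\<close>th eigenvalue is of order
  \<open>h powr (2 * s) * j powr (2 * s / d)\<close>, a strictly increasing function of \<open>j\<close> which at
  \<open>j = t * h powr (- d * \<theta>)\<close> equals \<open>t powr (2 * s / d) * h powr \<alpha>\<close>. A tolerance \<open>K * h powr \<alpha>\<close> is
  therefore met exactly up to an index of order \<open>h powr (- d * \<theta>)\<close>. The constants of the count can be
  chosen independently of \<open>k\<close> and \<open>\<alpha>\<close>: solving for the index takes the root of order \<open>2 * s / d\<close>,
  which turns the \<open>s\<close>-dependent powers of \<open>C\<^sub>2 / C\<^sub>1\<close> and \<open>c\<^sub>2 / c\<^sub>1\<close> into bounded ones.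
\<close>

section \<open>Elementary estimates on orders of magnitude, cardinalities and powers\<close>

lemma bigtheta_sandwichI:
  fixes f g :: "'a \<Rightarrow> real"
  assumes "A > 0" "B > 0"
    and ev: "\<forall>\<^sub>F x in F. 0 \<le> g x \<and> A * g x \<le> f x \<and> f x \<le> B * g x"
  shows "f \<in> \<Theta>[F](g)"
proof (rule bigthetaI)
  have *: "\<bar>f x\<bar> \<le> B * \<bar>g x\<bar> \<and> \<bar>f x\<bar> \<ge> A * \<bar>g x\<bar>"
    if "0 \<le> g x \<and> A * g x \<le> f x \<and> f x \<le> B * g x" for x
  proof -
    have "0 \<le> A * g x"
      using that \<open>A > 0\<close> by simp
    then show ?thesis
      using that by simp
  qed
  show "f \<in> O[F](g)"
    by (rule landau_o.bigI[OF \<open>B > 0\<close>]) (use ev * in \<open>auto elim: eventually_mono\<close>)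
  show "f \<in> \<Omega>[F](g)"
    by (rule landau_omega.bigI[OF \<open>A > 0\<close>]) (use ev * in \<open>auto elim: eventually_mono\<close>)
qed

lemma card_le_of_bounded:
  assumes "\<And>j. j \<in> S \<Longrightarrow> 1 \<le> j \<and> real j \<le> z" "0 \<le> z"
  shows "real (card S) \<le> z"
proof -
  have "S \<subseteq> {1..nat \<lfloor>z\<rfloor>}"
    using assms(1) by (auto simp: le_nat_floor)
  then have "card S \<le> nat \<lfloor>z\<rfloor>"
    using card_mono[of "{1..nat \<lfloor>z\<rfloor>}" S] by simp
  also have "real (nat \<lfloor>z\<rfloor>) \<le> z"
    using \<open>0 \<le> z\<close> by simp
  finally show ?thesis
    by simp
qed

text \<open>For \<open>x < 1\<close> a power decreases in its exponent; raising the base to at least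
  1 lets one bound serve all exponents in \<open>[0, q]\<close>.\<close>

lemma powr_le_max_one:
  fixes x p q :: real
  assumes "0 < x" "0 \<le> p" "p \<le> q"
  shows "x powr p \<le> max 1 x powr q"
  by (meson assms less_eq_real_def max.cobounded1 max.cobounded2 order_trans powr_mono powr_mono2)

text \<open>The exponents cancel: \<open>- d * ((s - \<alpha> / 2) / s)\<close> times
  \<open>2 * s / d\<close> is \<open>\<alpha> - 2 * s\<close>, and the prefactor restores
  \<alpha>.\<close>

lemma powr_scaled_index:
  fixes h t d s \<alpha> :: real
  assumes "0 < h" "0 \<le> t" "0 < d" "0 < s"
  shows "h powr (2 * s) * (t * h powr (- d * ((s - \<alpha> / 2) / s))) powr (2 * s / d)
    = t powr (2 * s / d) * h powr \<alpha>"
proof -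
  have "- d * ((s - \<alpha> / 2) / s) * (2 * s / d) = \<alpha> - 2 * s"
    using assms by (simp add: field_simps)
  then have "(t * h powr (- d * ((s - \<alpha> / 2) / s))) powr (2 * s / d)
      = t powr (2 * s / d) * h powr (\<alpha> - 2 * s)"
    by (simp only: powr_mult powr_powr)
  then show ?thesis
    by (simp add: powr_add[symmetric] mult.left_commute)
qed

text \<open>Over a single base, the hypothesis comparing N with
  \<open>(k - 1) ^ d * h powr (- d)\<close> translates directly into bounds of the count by powers
  of h.\<close>

lemma reliable_count_eq:
  assumes "k > 1"
  shows "reliable_count d m k \<alpha> N
    = (real N / (real k - 1) ^ d) powr ((real k - real m - \<alpha> / 2) / (real k - real m))"
proof -
  have "real k - 1 > 0"
    using assms by simp
  then have "(real k - 1) ^ d = (real k - 1) powr real d"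
    by (simp add: powr_realpow)
  then show ?thesis
    using \<open>real k - 1 > 0\<close>
    by (simp add: reliable_count_def Let_def powr_divide powr_powr powr_minus_divide)
qed

text \<open>The exponent \<open>k / m - 1\<close> is \<open>s / m\<close>, which is nonnegative, so
  the power preserves both inequalities. Its product with \<open>2 * m / d\<close> is
  \<open>2 * s / d\<close>, and m survives only in the constants.\<close>

lemma eigenvalue_powr_bounds:
  fixes C\<^sub>1 C\<^sub>2 x y d :: real
  assumes "C\<^sub>1 > 0" "C\<^sub>2 > 0" "x \<ge> 0" "d > 0" "m \<ge> 1" "k > m"
    and "C\<^sub>1 * x powr (2 * real m / d) \<le> y" "y \<le> C\<^sub>2 * x powr (2 * real m / d)"
  defines "s \<equiv> real k - real m"
  shows "C\<^sub>1 powr (s / m) * x powr (2 * s / d) \<le> y powr (real k / real m - 1)"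
    and "y powr (real k / real m - 1) \<le> C\<^sub>2 powr (s / m) * x powr (2 * s / d)"
proof -
  have s: "real k / real m - 1 = s / m" "0 \<le> s / m" "2 * real m / d * (s / m) = 2 * s / d"
    using assms by (auto simp: field_simps)
  have y: "0 \<le> C\<^sub>1 * x powr (2 * real m / d)"
    using assms by simp
  have eq: "(C * x powr (2 * real m / d)) powr (s / m) = C powr (s / m) * x powr (2 * s / d)"
    if "C > 0" for C
    using that by (simp only: powr_mult powr_powr s(3))
  show "C\<^sub>1 powr (s / m) * x powr (2 * s / d) \<le> y powr (real k / real m - 1)"
    using powr_mono2[OF s(2) y assms(7)] by (simp add: s(1) eq \<open>C\<^sub>1 > 0\<close>)
  show "y powr (real k / real m - 1) \<le> C\<^sub>2 powr (s / m) * x powr (2 * s / d)"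
    using powr_mono2[OF s(2) order_trans[OF y assms(7)] assms(8)] by (simp add: s(1) eq \<open>C\<^sub>2 > 0\<close>)
qed

section \<open>Counting indices at one fixed mesh size\<close>

text \<open>\<open>X\<close> stands for the degrees of freedom divided by
  \<open>(k - 1) ^ d\<close>, and \<open>e\<close> for the relative error. No limit occurs here, so
  the bounds below carry explicit constants free of h. The range of \<open>X\<close> keeps the count
  \<open>X powr \<theta>\<close> between 1 and \<open>N\<close>, where the error bounds are
  available.\<close>

locale power_law_error =
  fixes d s \<alpha> L U c\<^sub>1 c\<^sub>2 h X :: real and e :: "nat \<Rightarrow> real" and N :: nat
  assumes pos: "0 < d" "0 < s" "0 < \<alpha>" "0 < L" "0 < U" "0 < c\<^sub>1" "0 < c\<^sub>2" "0 < h"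
    and alpha_le: "\<alpha> \<le> 2 * s"
    and X_lower: "c\<^sub>1 * h powr (- d) \<le> X" and X_upper: "X \<le> c\<^sub>2 * h powr (- d)"
    and X_range: "1 \<le> X" "X \<le> N"
    and e_lower: "\<And>j. j \<in> {1..N} \<Longrightarrow> L * (h powr (2 * s) * real j powr (2 * s / d)) \<le> e j"
    and e_upper: "\<And>j. j \<in> {1..N} \<Longrightarrow> e j \<le> U * (h powr (2 * s) * real j powr (2 * s / d))"
begin

definition "\<theta> = (s - \<alpha> / 2) / s"

lemma theta: "0 \<le> \<theta>" "\<theta> \<le> 1"
  using pos alpha_le by (simp_all add: \<theta>_def field_simps)

lemma count_ge_1: "1 \<le> X powr \<theta>"
  using X_range theta by (simp add: ge_one_powr_ge_zero)

lemma count_le: "X powr \<theta> \<le> N"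
proof -
  have "X powr \<theta> \<le> X powr 1"
    using X_range theta by (intro powr_mono) auto
  then show ?thesis
    using X_range by simp
qed

lemma count_bounds:
  "c\<^sub>1 powr \<theta> * h powr (- d * \<theta>) \<le> X powr \<theta>" "X powr \<theta> \<le> c\<^sub>2 powr \<theta> * h powr (- d * \<theta>)"
proof -
  have eq: "(c * h powr (- d)) powr \<theta> = c powr \<theta> * h powr (- d * \<theta>)" if "c > 0" for c
    using that by (simp add: powr_mult powr_powr)
  have "(c\<^sub>1 * h powr (- d)) powr \<theta> \<le> X powr \<theta>"
    using X_lower pos theta by (intro powr_mono2) auto
  then show "c\<^sub>1 powr \<theta> * h powr (- d * \<theta>) \<le> X powr \<theta>"
    using eq pos by simp
  have "X powr \<theta> \<le> (c\<^sub>2 * h powr (- d)) powr \<theta>"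
    using X_upper X_range theta by (intro powr_mono2) auto
  then show "X powr \<theta> \<le> c\<^sub>2 powr \<theta> * h powr (- d * \<theta>)"
    using eq pos by simp
qed

lemma scaled:
  "0 \<le> t \<Longrightarrow> h powr (2 * s) * (t * h powr (- d * \<theta>)) powr (2 * s / d) = t powr (2 * s / d) * h powr \<alpha>"
  unfolding \<theta>_def using powr_scaled_index pos by simp

text \<open>The upper error law increases with j, so it suffices to evaluate it at the upper bound
  of the count from \<open>count_bounds\<close>, where \<open>scaled\<close> applies.\<close>

lemma error_le:
  assumes "1 \<le> j" "real j \<le> X powr \<theta>"
  shows "e j \<le> U * c\<^sub>2 powr (2 * s * \<theta> / d) * h powr \<alpha>"
proof -
  have "j \<in> {1..N}"
    using assms count_le by simp
  then have "e j \<le> U * (h powr (2 * s) * real j powr (2 * s / d))"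
    by (rule e_upper)
  also have "\<dots> \<le> U * (h powr (2 * s) * (c\<^sub>2 powr \<theta> * h powr (- d * \<theta>)) powr (2 * s / d))"
    using pos assms count_bounds by (intro mult_left_mono powr_mono2) auto
  also have "\<dots> = U * c\<^sub>2 powr (2 * s * \<theta> / d) * h powr \<alpha>"
    using scaled[of "c\<^sub>2 powr \<theta>"] by (simp add: powr_powr mult.commute)
  finally show ?thesis .
qed

lemma floor_count:
  "1 \<le> nat \<lfloor>X powr \<theta>\<rfloor>" "nat \<lfloor>X powr \<theta>\<rfloor> \<le> N"
  "real (nat \<lfloor>X powr \<theta>\<rfloor>) \<le> X powr \<theta>" "X powr \<theta> / 2 \<le> real (nat \<lfloor>X powr \<theta>\<rfloor>)"
proof -
  show "1 \<le> nat \<lfloor>X powr \<theta>\<rfloor>"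
    using count_ge_1 by (simp add: le_nat_floor)
  \<comment> \<open>A number with floor \<open>n \<ge> 1\<close> is below
    \<open>n + 1 \<le> 2 * n\<close>; hence the factor 1/2 in the counts.\<close>
  then show "X powr \<theta> / 2 \<le> real (nat \<lfloor>X powr \<theta>\<rfloor>)"
    by linarith
  show le: "real (nat \<lfloor>X powr \<theta>\<rfloor>) \<le> X powr \<theta>"
    by simp
  show "nat \<lfloor>X powr \<theta>\<rfloor> \<le> N"
    using order_trans[OF le count_le] by simp
qed

lemma error_at_count_ge:
  "L * (c\<^sub>1 powr \<theta> / 2) powr (2 * s / d) * h powr \<alpha> \<le> e (nat \<lfloor>X powr \<theta>\<rfloor>)"
proof -
  \<comment> \<open>Half the lower bound of the count still lies below the rounded index, and
    \<open>scaled\<close> evaluates the lower law there.\<close>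
  have "L * (c\<^sub>1 powr \<theta> / 2) powr (2 * s / d) * h powr \<alpha>
      = L * (h powr (2 * s) * (c\<^sub>1 powr \<theta> / 2 * h powr (- d * \<theta>)) powr (2 * s / d))"
    using scaled[of "c\<^sub>1 powr \<theta> / 2"] by simp
  also have "\<dots> \<le> L * (h powr (2 * s) * real (nat \<lfloor>X powr \<theta>\<rfloor>) powr (2 * s / d))"
    using pos count_bounds(1) floor_count(4) by (intro mult_left_mono powr_mono2) auto
  also have "\<dots> \<le> e (nat \<lfloor>X powr \<theta>\<rfloor>)"
    using floor_count by (intro e_lower) simp
  finally show ?thesis .
qed

text \<open>Inverts the lower error law: past the index where that law reaches the tolerance, the
  error exceeds it.\<close>

lemma index_le:
  assumes "j \<in> {1..N}" "e j \<le> K * h powr \<alpha>"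
  shows "real j \<le> (K / L) powr (d / (2 * s)) / c\<^sub>1 powr \<theta> * X powr \<theta>"
proof -
  \<comment> \<open>The solution of \<open>L * t powr (2 * s / d) = K\<close>, so that the lower law
    at \<open>t * h powr (- d * \<theta>)\<close> equals the tolerance.\<close>
  define t where "t = (K / L) powr (d / (2 * s))"
  have less: "L * (h powr (2 * s) * real j powr (2 * s / d)) \<le> K * h powr \<alpha>"
    using e_lower[OF assms(1)] assms(2) by linarith
  \<comment> \<open>The sign of K comes from j itself: its error has a positive lower bound and is
    at most the tolerance.\<close>
  have "0 < K * h powr \<alpha>"
    using less pos assms(1) by (intro less_le_trans[OF _ less]) simp
  then have K: "0 < K"
    using pos by (simp add: zero_less_mult_iff)
  then have t: "t powr (2 * s / d) = K / L" "0 < t"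
    using pos by (simp_all add: t_def powr_powr)
  have "real j \<le> t * h powr (- d * \<theta>)"
  proof (rule ccontr)
    assume "\<not> ?thesis"
    then have "(t * h powr (- d * \<theta>)) powr (2 * s / d) < real j powr (2 * s / d)"
      using pos t by (intro powr_less_mono2) auto
    then have "L * (h powr (2 * s) * (t * h powr (- d * \<theta>)) powr (2 * s / d))
        < L * (h powr (2 * s) * real j powr (2 * s / d))"
      using pos by simp
    moreover have "L * (h powr (2 * s) * (t * h powr (- d * \<theta>)) powr (2 * s / d)) = K * h powr \<alpha>"
      using scaled[of t] t pos by simp
    ultimately show False
      using less by linarith
  qed
  also have "\<dots> \<le> t / c\<^sub>1 powr \<theta> * X powr \<theta>"
    using mult_left_mono[OF count_bounds(1), of "t / c\<^sub>1 powr \<theta>"] t pos by simp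
  finally show ?thesis
    by (simp add: t_def)
qed

lemma card_le:
  "real (card {j\<in>{1..N}. e j \<le> K * h powr \<alpha>})
    \<le> (K / L) powr (d / (2 * s)) / c\<^sub>1 powr \<theta> * X powr \<theta>"
  by (rule card_le_of_bounded) (use index_le in auto)

text \<open>K dominates the constant of \<open>error_le\<close>, which covers all indices up to the
  count at once.\<close>

lemma initial_segment:
  assumes "U * c\<^sub>2 powr (2 * s * \<theta> / d) \<le> K"
  shows "{1..nat \<lfloor>X powr \<theta>\<rfloor>} \<subseteq> {j\<in>{1..N}. e j \<le> K * h powr \<alpha>}"
proof safe
  fix j assume j: "j \<in> {1..nat \<lfloor>X powr \<theta>\<rfloor>}"
  then show "j \<in> {1..N}"
    using floor_count(2) by simp
  have "e j \<le> U * c\<^sub>2 powr (2 * s * \<theta> / d) * h powr \<alpha>"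
  proof (rule error_le)
    show "real j \<le> X powr \<theta>"
      using j floor_count(3) by (meson atLeastAtMost_iff of_nat_mono order_trans)
  qed (use j in simp)
  also have "\<dots> \<le> K * h powr \<alpha>"
    using assms by (intro mult_right_mono) auto
  finally show "e j \<le> K * h powr \<alpha>" .
qed

lemma card_ge:
  assumes "U * c\<^sub>2 powr (2 * s * \<theta> / d) \<le> K"
  shows "1 / 2 * X powr \<theta> \<le> real (card {j\<in>{1..N}. e j \<le> K * h powr \<alpha>})"
proof -
  have "nat \<lfloor>X powr \<theta>\<rfloor> \<le> card {j\<in>{1..N}. e j \<le> K * h powr \<alpha>}"
    using card_mono[OF _ initial_segment[OF assms]] by simp
  then show ?thesis
    using floor_count(4) by linarith
qed

end

section \<open>Independence of the counting constant from degree and rate\<close>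

text \<open>The left side is the constant of \<open>index_le\<close> at
  \<open>K = U * c\<^sub>2 powr (2 * s * \<theta> / d)\<close>, with \<open>L\<close> and
  \<open>U\<close> expanded. The right side is free of s and \<theta>, hence serves all degrees and
  rates.\<close>

lemma reliable_constant_bound:
  fixes C\<^sub>1 C\<^sub>2 E\<^sub>1 E\<^sub>2 c\<^sub>1 c\<^sub>2 d s \<theta> :: real
  assumes pos: "C\<^sub>1 > 0" "C\<^sub>2 > 0" "E\<^sub>1 > 0" "E\<^sub>2 > 0" "c\<^sub>1 > 0" "c\<^sub>2 > 0" "d > 0"
    and s: "1 \<le> s" and \<theta>: "0 \<le> \<theta>" "\<theta> \<le> 1" and m: "m \<ge> (1 :: nat)"
  shows "(E\<^sub>2 * C\<^sub>2 powr (s / m) * c\<^sub>2 powr (2 * s * \<theta> / d) / (E\<^sub>1 * C\<^sub>1 powr (s / m))) powr (d / (2 * s))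
      / c\<^sub>1 powr \<theta>
    \<le> max 1 (E\<^sub>2 / E\<^sub>1) powr (d / 2) * (C\<^sub>2 / C\<^sub>1) powr (d / (2 * m)) * max 1 (c\<^sub>2 / c\<^sub>1) powr 1"
proof -
  have "d / (2 * s) \<le> d / 2"
    using s pos by (intro frac_le) auto
  \<comment> \<open>Under the root, s cancels from the exponent of
    \<open>C\<^sub>2 / C\<^sub>1\<close>, and \<open>c\<^sub>2\<close> keeps only the exponent
    \<theta>.\<close>
  have exps: "s / m * (d / (2 * s)) = d / (2 * m)" "2 * s * \<theta> / d * (d / (2 * s)) = \<theta>"
    using s pos by auto
  have "E\<^sub>2 * C\<^sub>2 powr (s / m) * c\<^sub>2 powr (2 * s * \<theta> / d) / (E\<^sub>1 * C\<^sub>1 powr (s / m))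
      = (E\<^sub>2 / E\<^sub>1) * (C\<^sub>2 / C\<^sub>1) powr (s / m) * c\<^sub>2 powr (2 * s * \<theta> / d)"
    using pos by (simp add: powr_divide)
  also have "\<dots> powr (d / (2 * s))
      = (E\<^sub>2 / E\<^sub>1) powr (d / (2 * s)) * (C\<^sub>2 / C\<^sub>1) powr (d / (2 * m)) * c\<^sub>2 powr \<theta>"
    using pos by (simp only: powr_mult powr_powr exps)
  also have "\<dots> / c\<^sub>1 powr \<theta>
      = (E\<^sub>2 / E\<^sub>1) powr (d / (2 * s)) * (C\<^sub>2 / C\<^sub>1) powr (d / (2 * m)) * (c\<^sub>2 / c\<^sub>1) powr \<theta>"
    using pos by (simp add: powr_divide)
  \<comment> \<open>The exponents that still vary lie in \<open>[0, d / 2]\<close>, because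
    \<open>1 \<le> s\<close>, and in \<open>[0, 1]\<close>.\<close>
  also have "\<dots> \<le> max 1 (E\<^sub>2 / E\<^sub>1) powr (d / 2) * (C\<^sub>2 / C\<^sub>1) powr (d / (2 * m))
      * max 1 (c\<^sub>2 / c\<^sub>1) powr 1"
    using pos s \<theta> \<open>d / (2 * s) \<le> d / 2\<close>
    by (intro mult_mono powr_le_max_one) auto
  finally show ?thesis .
qed

section \<open>Reliable eigenvalues as h tends to 0\<close>

text \<open>\<open>A\<close> and \<open>B\<close> are quantified before degree, rate and
  discretisation, which makes the count uniform in them; the threshold \<open>K\<^sub>0\<close> may
  depend on all three. Since 0 is a limit point of I, the eventual claims are not vacuous.\<close>

theorem mainTheorem1:
  fixes \<Omega> :: "(real ^ 'd::finite) set" and H :: "'d mfun set"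
    and a b :: "'d mfun \<Rightarrow> 'd mfun \<Rightarrow> real" and lam :: "nat \<Rightarrow> real" and m :: nat
    and C\<^sub>1 C\<^sub>2 E\<^sub>1 E\<^sub>2 c\<^sub>1 c\<^sub>2 :: real
  defines "d \<equiv> CARD('d)"
  assumes "m \<ge> 1" and "elliptic_eigenproblem m \<Omega> H a b lam"
    and "C\<^sub>1 > 0" "C\<^sub>2 > 0" "E\<^sub>1 > 0" "E\<^sub>2 > 0" "c\<^sub>1 > 0" "c\<^sub>2 > 0"
    and growth: "\<And>j. j \<ge> 1 \<Longrightarrow> C\<^sub>1 * real j powr (2 * real m / real d) \<le> lam j \<and>
                              lam j \<le> C\<^sub>2 * real j powr (2 * real m / real d)"
  shows "\<exists>A>0. \<exists>B>0. \<forall>k \<alpha> I T V ah bh lamh.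
    k > m \<and> 0 < \<alpha> \<and> \<alpha> \<le> 2 * (real k - real m) \<and>
    fe_discretisation \<Omega> H a b (k - 1) I T V ah bh lamh \<and>
    (\<forall>h\<in>I. c\<^sub>1 * ((real k - 1) ^ d * h powr (- real d)) \<le> real (dim (V h)) \<and>
           real (dim (V h)) \<le> c\<^sub>2 * ((real k - 1) ^ d * h powr (- real d))) \<and>
    (\<forall>h\<in>I. \<forall>j\<in>{1..dim (V h)}.
       E\<^sub>1 * (h powr (2 * (real k - real m)) * lam j powr (real k / real m - 1))
         \<le> rel_err lam lamh h j \<and>
       rel_err lam lamh h j
         \<le> E\<^sub>2 * (h powr (2 * (real k - real m)) * lam j powr (real k / real m - 1)))
    \<longrightarrow>
    (let N = (\<lambda>h. dim (V h));
         jN = (\<lambda>h. reliable_count d m k \<alpha> (N h));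
         R = (\<lambda>K h. reliable lam lamh (N h) \<alpha> K h)
     in (\<forall>\<^sub>F h in at 0 within I. 1 \<le> nat \<lfloor>jN h\<rfloor> \<and> nat \<lfloor>jN h\<rfloor> \<le> N h) \<and>
        (\<lambda>h. rel_err lam lamh h (nat \<lfloor>jN h\<rfloor>)) \<in> \<Theta>[at 0 within I](\<lambda>h. h powr \<alpha>) \<and>
        (\<exists>K\<^sub>0>0.
          (\<forall>\<^sub>F h in at 0 within I. A * jN h \<le> real (card (R K\<^sub>0 h)) \<and>
                                   real (card (R K\<^sub>0 h)) \<le> B * jN h) \<and>
          (\<forall>K\<ge>K\<^sub>0. (\<forall>\<^sub>F h in at 0 within I. {1..nat \<lfloor>jN h\<rfloor>} \<subseteq> R K h) \<and>
                   (\<lambda>h. real (card (R K h))) \<in> \<Theta>[at 0 within I](jN))))"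
proof -
  \<comment> \<open>\<open>A\<close> is the rounding loss in \<open>card_ge\<close>, and
    \<open>B\<close> the right side of \<open>reliable_constant_bound\<close>.\<close>
  define A B :: real where "A = 1 / 2"
    and "B = max 1 (E\<^sub>2 / E\<^sub>1) powr (d / 2) * (C\<^sub>2 / C\<^sub>1) powr (d / (2 * m)) * max 1 (c\<^sub>2 / c\<^sub>1) powr 1"
  have d: "0 < real d"
    by (simp add: d_def)
  have "A > 0" "B > 0"
    using assms(4-9) by (auto simp: A_def B_def)
  show ?thesis
  proof (rule exI[of _ A], rule conjI[OF \<open>A > 0\<close>], rule exI[of _ B], rule conjI[OF \<open>B > 0\<close>],
      intro allI impI, elim conjE, unfold Let_def)
    fix k :: nat and \<alpha> :: real and I :: "real set" and T :: "real \<Rightarrow> (real ^ 'd) set set"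
      and V :: "real \<Rightarrow> 'd mfun set" and ah bh :: "real \<Rightarrow> 'd mfun \<Rightarrow> 'd mfun \<Rightarrow> real"
      and lamh :: "real \<Rightarrow> nat \<Rightarrow> real"
    assume k: "k > m" and \<alpha>: "0 < \<alpha>" "\<alpha> \<le> 2 * (real k - real m)"
      and fe: "fe_discretisation \<Omega> H a b (k - 1) I T V ah bh lamh"
      and dim: "\<forall>h\<in>I. c\<^sub>1 * ((real k - 1) ^ d * h powr (- real d)) \<le> real (dim (V h)) \<and>
           real (dim (V h)) \<le> c\<^sub>2 * ((real k - 1) ^ d * h powr (- real d))"
      and err: "\<forall>h\<in>I. \<forall>j\<in>{1..dim (V h)}.
       E\<^sub>1 * (h powr (2 * (real k - real m)) * lam j powr (real k / real m - 1))
         \<le> rel_err lam lamh h j \<and>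
       rel_err lam lamh h j
         \<le> E\<^sub>2 * (h powr (2 * (real k - real m)) * lam j powr (real k / real m - 1))"
    define s \<theta> where "s = real k - real m" and "\<theta> = (s - \<alpha> / 2) / s"
    define L U where "L = E\<^sub>1 * C\<^sub>1 powr (s / m)" and "U = E\<^sub>2 * C\<^sub>2 powr (s / m)"
    \<comment> \<open>The constant of \<open>error_le\<close>: with this tolerance every index up to
      the count is reliable.\<close>
    define K\<^sub>0 where "K\<^sub>0 = U * c\<^sub>2 powr (2 * s * \<theta> / d)"
    define X where "X h = real (dim (V h)) / (real k - 1) ^ d" for h
    define e where "e h = rel_err lam lamh h" for h
    have s: "1 \<le> s"
      using k by (simp add: s_def)
    have LU: "0 < L" "0 < U" "0 < K\<^sub>0"
      using assms(4-9) by (auto simp: L_def U_def K\<^sub>0_def)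
    have \<theta>: "0 \<le> \<theta>" "\<theta> \<le> 1"
      using s \<alpha> by (simp_all add: \<theta>_def s_def field_simps)
    have jN: "reliable_count d m k \<alpha> (dim (V h)) = X h powr \<theta>" for h
      using k \<open>m \<ge> 1\<close> by (simp add: reliable_count_eq X_def \<theta>_def s_def)
    have I: "h > 0" if "h \<in> I" for h
      using fe that by (auto simp: fe_discretisation_def)
    have k1: "1 \<le> (real k - 1) ^ d"
      using k \<open>m \<ge> 1\<close> by (intro one_le_power) simp
    \<comment> \<open>The constants of the eigenvalue growth are absorbed into \<open>L\<close> and
      \<open>U\<close>, leaving a pure power law in j. The condition \<open>1 \<le> X h\<close>
      stays a premise because it is secured only for small h.\<close>
    have law: "power_law_error d s \<alpha> L U c\<^sub>1 c\<^sub>2 h (X h) (e h) (dim (V h))"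
      if h: "h \<in> I" and "1 \<le> X h" for h
    proof
      show "c\<^sub>1 * h powr - real d \<le> X h" "X h \<le> c\<^sub>2 * h powr - real d"
        using dim h k1 by (auto simp: X_def field_simps)
      show "X h \<le> real (dim (V h))"
        using k1 by (simp add: X_def divide_le_eq mult_le_cancel_left1)
      fix j assume j: "j \<in> {1..dim (V h)}"
      then have "C\<^sub>1 * real j powr (2 * real m / real d) \<le> lam j"
        "lam j \<le> C\<^sub>2 * real j powr (2 * real m / real d)"
        using growth[of j] by auto
      note lam = eigenvalue_powr_bounds[OF \<open>C\<^sub>1 > 0\<close> \<open>C\<^sub>2 > 0\<close> of_nat_0_le_iff d \<open>m \<ge> 1\<close> k this,
          folded s_def]
      have "L * (h powr (2 * s) * real j powr (2 * s / real d))
          = E\<^sub>1 * (h powr (2 * s) * (C\<^sub>1 powr (s / m) * real j powr (2 * s / real d)))"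
        by (simp add: L_def)
      also have "\<dots> \<le> E\<^sub>1 * (h powr (2 * s) * lam j powr (real k / real m - 1))"
        using lam(1) \<open>E\<^sub>1 > 0\<close> by (intro mult_left_mono) auto
      also have "\<dots> \<le> e h j"
        using err h j by (simp add: e_def s_def)
      finally show "L * (h powr (2 * s) * real j powr (2 * s / real d)) \<le> e h j" .
      have "e h j \<le> E\<^sub>2 * (h powr (2 * s) * lam j powr (real k / real m - 1))"
        using err h j by (simp add: e_def s_def)
      also have "\<dots> \<le> E\<^sub>2 * (h powr (2 * s) * (C\<^sub>2 powr (s / m) * real j powr (2 * s / real d)))"
        using lam(2) \<open>E\<^sub>2 > 0\<close> by (intro mult_left_mono) auto
      also have "\<dots> = U * (h powr (2 * s) * real j powr (2 * s / real d))"
        by (simp add: U_def)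
      finally show "e h j \<le> U * (h powr (2 * s) * real j powr (2 * s / real d))" .
    qed (use d s \<alpha> LU that I assms(4-9) in \<open>auto simp: s_def\<close>)
    have theta_eq: "power_law_error.\<theta> s \<alpha> = \<theta>"
      if "power_law_error d s \<alpha> L U c\<^sub>1 c\<^sub>2 h (X h) (e h) (dim (V h))" for h
      using power_law_error.\<theta>_def[OF that] by (simp add: \<theta>_def)
    have ev: "\<forall>\<^sub>F h in at 0 within I. power_law_error d s \<alpha> L U c\<^sub>1 c\<^sub>2 h (X h) (e h) (dim (V h))"
    proof -
      \<comment> \<open>Once \<open>h ^ d < c\<^sub>1\<close>, the lower bound
        \<open>c\<^sub>1 * h powr (- d)\<close> of \<open>X h\<close> is at least 1.\<close>
      have "((\<lambda>h. h ^ d) \<longlongrightarrow> 0) (at 0 within I)"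
        using d by (auto intro!: tendsto_eq_intros)
      then have "\<forall>\<^sub>F h in at 0 within I. h ^ d < c\<^sub>1"
        using \<open>c\<^sub>1 > 0\<close> by (rule order_tendstoD)
      moreover have "\<forall>\<^sub>F h in at 0 within I. h \<in> I"
        by (simp add: eventually_at_filter)
      ultimately show ?thesis
      proof eventually_elim
        case (elim h)
        then have "1 \<le> c\<^sub>1 * h powr - real d"
          using I[of h] by (simp add: powr_minus powr_realpow field_simps)
        also have "\<dots> \<le> X h"
          using dim elim k1 by (auto simp: X_def field_simps)
        finally show ?case
          using law elim by simp
      qed
    qed
    have B: "(K\<^sub>0 / L) powr (d / (2 * s)) / c\<^sub>1 powr \<theta> \<le> B"
      unfolding B_def K\<^sub>0_def L_def U_def
      using assms(4-9) d s \<theta> \<open>m \<ge> 1\<close> by (rule reliable_constant_bound)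
    have R: "reliable lam lamh (dim (V h)) \<alpha> K h = {j\<in>{1..dim (V h)}. e h j \<le> K * h powr \<alpha>}" for K h
      by (simp add: reliable_def e_def)

    \<comment> \<open>Range, rate and count for small h\<close>
    have range: "\<forall>\<^sub>F h in at 0 within I. 1 \<le> nat \<lfloor>X h powr \<theta>\<rfloor> \<and> nat \<lfloor>X h powr \<theta>\<rfloor> \<le> dim (V h)"
      using ev by (rule eventually_mono) (metis power_law_error.floor_count(1,2) theta_eq)
    have rate: "(\<lambda>h. e h (nat \<lfloor>X h powr \<theta>\<rfloor>)) \<in> \<Theta>[at 0 within I](\<lambda>h. h powr \<alpha>)"
    proof (rule bigtheta_sandwichI)
      show "0 < L * (c\<^sub>1 powr \<theta> / 2) powr (2 * s / d)" "0 < K\<^sub>0"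
        using LU assms(8) by auto
      show "\<forall>\<^sub>F h in at 0 within I. 0 \<le> h powr \<alpha> \<and>
          L * (c\<^sub>1 powr \<theta> / 2) powr (2 * s / d) * h powr \<alpha> \<le> e h (nat \<lfloor>X h powr \<theta>\<rfloor>) \<and>
          e h (nat \<lfloor>X h powr \<theta>\<rfloor>) \<le> K\<^sub>0 * h powr \<alpha>"
        using ev
      proof eventually_elim
        case (elim h)
        note [simp] = theta_eq[OF elim]
        show ?case
          using power_law_error.error_at_count_ge[OF elim] power_law_error.floor_count[OF elim]
            power_law_error.error_le[OF elim, of "nat \<lfloor>X h powr \<theta>\<rfloor>"]
          by (simp add: K\<^sub>0_def)
      qed
    qed
    have lower: "\<forall>\<^sub>F h in at 0 within I.
        A * X h powr \<theta> \<le> real (card {j\<in>{1..dim (V h)}. e h j \<le> K * h powr \<alpha>})"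
      if "K\<^sub>0 \<le> K" for K
      using ev
    proof eventually_elim
      case (elim h)
      then show ?case
        using power_law_error.card_ge[OF elim, of K] theta_eq[OF elim] that
        by (simp add: A_def K\<^sub>0_def)
    qed
    \<comment> \<open>This constant may vary with K, degree and rate, which is enough for the
      \<Theta> claim.\<close>
    have upper: "\<forall>\<^sub>F h in at 0 within I. real (card {j\<in>{1..dim (V h)}. e h j \<le> K * h powr \<alpha>})
        \<le> (K / L) powr (d / (2 * s)) / c\<^sub>1 powr \<theta> * X h powr \<theta>" for K
      using ev
    proof eventually_elim
      case (elim h)
      show ?case
        by (fact power_law_error.card_le[OF elim, unfolded theta_eq[OF elim]])
    qed
    \<comment> \<open>At the threshold itself the constant is replaced by the uniform
      \<open>B\<close>.\<close>
    have upper\<^sub>0: "\<forall>\<^sub>F h in at 0 within I.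
        real (card {j\<in>{1..dim (V h)}. e h j \<le> K\<^sub>0 * h powr \<alpha>}) \<le> B * X h powr \<theta>"
      using upper[of K\<^sub>0]
    proof eventually_elim
      case (elim h)
      then show ?case
        using mult_right_mono[OF B, of "X h powr \<theta>"] by (meson order_trans powr_ge_zero)
    qed
    have segment: "\<forall>\<^sub>F h in at 0 within I.
        {1..nat \<lfloor>X h powr \<theta>\<rfloor>} \<subseteq> {j\<in>{1..dim (V h)}. e h j \<le> K * h powr \<alpha>}"
      if "K\<^sub>0 \<le> K" for K
      using ev
    proof eventually_elim
      case (elim h)
      then show ?case
        using power_law_error.initial_segment[OF elim, of K] theta_eq[OF elim] that
        by (simp add: K\<^sub>0_def)
    qed
    have count: "(\<lambda>h. real (card {j\<in>{1..dim (V h)}. e h j \<le> K * h powr \<alpha>}))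
        \<in> \<Theta>[at 0 within I](\<lambda>h. X h powr \<theta>)"
      if "K\<^sub>0 \<le> K" for K
    proof (rule bigtheta_sandwichI[OF \<open>A > 0\<close>])
      show "0 < (K / L) powr (d / (2 * s)) / c\<^sub>1 powr \<theta>"
        using LU that \<open>c\<^sub>1 > 0\<close> by simp
      show "\<forall>\<^sub>F h in at 0 within I. 0 \<le> X h powr \<theta> \<and>
          A * X h powr \<theta> \<le> real (card {j\<in>{1..dim (V h)}. e h j \<le> K * h powr \<alpha>}) \<and>
          real (card {j\<in>{1..dim (V h)}. e h j \<le> K * h powr \<alpha>})
            \<le> (K / L) powr (d / (2 * s)) / c\<^sub>1 powr \<theta> * X h powr \<theta>"
        using lower[OF that] upper[of K] by eventually_elim simp
    qed
    show "(\<forall>\<^sub>F h in at 0 within I. 1 \<le> nat \<lfloor>reliable_count d m k \<alpha> (dim (V h))\<rfloor> \<and>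
            nat \<lfloor>reliable_count d m k \<alpha> (dim (V h))\<rfloor> \<le> dim (V h)) \<and>
        (\<lambda>h. rel_err lam lamh h (nat \<lfloor>reliable_count d m k \<alpha> (dim (V h))\<rfloor>))
          \<in> \<Theta>[at 0 within I](\<lambda>h. h powr \<alpha>) \<and>
        (\<exists>K\<^sub>0>0.
          (\<forall>\<^sub>F h in at 0 within I.
            A * reliable_count d m k \<alpha> (dim (V h)) \<le> real (card (reliable lam lamh (dim (V h)) \<alpha> K\<^sub>0 h)) \<and>
            real (card (reliable lam lamh (dim (V h)) \<alpha> K\<^sub>0 h)) \<le> B * reliable_count d m k \<alpha> (dim (V h))) \<and>
          (\<forall>K\<ge>K\<^sub>0.
            (\<forall>\<^sub>F h in at 0 within I. {1..nat \<lfloor>reliable_count d m k \<alpha> (dim (V h))\<rfloor>}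
              \<subseteq> reliable lam lamh (dim (V h)) \<alpha> K h) \<and>
            (\<lambda>h. real (card (reliable lam lamh (dim (V h)) \<alpha> K h)))
              \<in> \<Theta>[at 0 within I](\<lambda>h. reliable_count d m k \<alpha> (dim (V h)))))"
      unfolding jN R e_def[symmetric]
      using range rate \<open>0 < K\<^sub>0\<close> eventually_conj[OF lower[OF order_refl] upper\<^sub>0] segment count
      by blast
  qed
qed

end
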